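(* Let $\lambda\ge 2$ be an integer and $\delta\ne0$ a real number. Let $f_a,f_b:[0,\lambda]\to\mathbb{R}$ be functions with $f_a(0)=f_a(\lambda)=f_b(0)=f_b(\lambda)$ and let $w\in\{a,b\}^{\mathbb{N}}$ be such that the concatenation $f=f_w:[0,\infty[\to\mathbb{R}$ of $f_a$ and $f_b$ along $w$ is a solution of $$\int_0^{\lambda x} f(t)\,dt=\delta\,\big(f(x)-f(0)\big)\qquad\text{for all } x\ge 0.$$ If $f$ is not identically zero, then there exists a unique $\lambda$-uniform substitution $\sigma$ on $\{a,b\}$ such that $\sigma(w)=w$. Moreover $|\sigma(a)|_a=|\sigma(b)|_a$ and for all $x,y\in[0,\lambda]$ $$\int_{\lambda x}^{\lambda y} f_{\sigma(a)}(t)\,dt=\delta\,\big(f_a(y)-f_a(x)\big)\quad\text{and}\quad \int_{\lambda x}^{\lambda y} f_{\sigma(b)}(t)\,dt=\delta\,\big(f_b(y)-f_b(x)\big).$$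
   Context: For an infinite word $w=w_0w_1\ldots\in\{a,b\}^{\mathbb{N}}$, the concatenation $f_w:[0,\infty[\to\mathbb{R}$ of $f_a,f_b$ along $w$ is defined by $f_w(n\lambda+x)=f_{w_n}(x)$ for $x\in[0,\lambda]$, $n\in\mathbb{N}$. For a finite word $u$ of length $|u|$, $f_u$ is defined on $[0,|u|\lambda]$ by the same formula. A solution is understood to be integrable on bounded intervals (it is then automatically continuous). $|u|_\alpha$ is the number of occurrences of the letter $\alpha$ in the finite word $u$. A substitution $\sigma$ on $\{a,b\}$ is a morphism of the free monoid $\{a,b\}^*$ (determined by $\sigma(a),\sigma(b)$); it acts on infinite words by $\sigma(w_0w_1\ldots)=\sigma(w_0)\sigma(w_1)\ldots$. It is $\lambda$-uniform if $|\sigma(a)|=|\sigma(b)|=\lambda$. *)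

theory Defs
  imports "HOL-Analysis.Analysis" "HOL-Library.Stream"
begin

datatype letter = La | Lb

definition pick :: "(real \<Rightarrow> real) \<Rightarrow> (real \<Rightarrow> real) \<Rightarrow> letter \<Rightarrow> real \<Rightarrow> real" where
  "pick fa fb c = (case c of La \<Rightarrow> fa | Lb \<Rightarrow> fb)"

text \<open>Functions on \<open>[0, L]\<close> are total functions on the reals of which only the values on
  \<open>[0, L]\<close> are used; the concatenations below are meaningful on \<open>[0, \<infinity>)\<close> and
  \<open>[0, |u| L]\<close>, respectively.\<close>

definition concat_inf ::
  "nat \<Rightarrow> (real \<Rightarrow> real) \<Rightarrow> (real \<Rightarrow> real) \<Rightarrow> letter stream \<Rightarrow> real \<Rightarrow> real" where
  "concat_inf L fa fb w t =
     (let n = nat \<lfloor>t / real L\<rfloor> in pick fa fb (w !! n) (t - real n * real L))"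

text \<open>The minimum makes the right end point \<open>t = |u| L\<close> belong to the last block.\<close>

definition concat_fin ::
  "nat \<Rightarrow> (real \<Rightarrow> real) \<Rightarrow> (real \<Rightarrow> real) \<Rightarrow> letter list \<Rightarrow> real \<Rightarrow> real" where
  "concat_fin L fa fb u t =
     (let n = min (nat \<lfloor>t / real L\<rfloor>) (length u - 1)
      in pick fa fb (u ! n) (t - real n * real L))"

lemma block_index:
  assumes "0 < L" "0 \<le> x" "x < real L"
  shows "nat \<lfloor>(real n * real L + x) / real L\<rfloor> = n"
proof -
  have "\<lfloor>(real n * real L + x) / real L\<rfloor> = int n"
    using assms by (intro floor_unique) (auto simp: field_simps)
  then show ?thesis by simp
qed

lemma block_index_end:
  assumes "0 < L"
  shows "nat \<lfloor>(real n * real L + real L) / real L\<rfloor> = Suc n"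
  using block_index[of L 0 "Suc n"] assms by (simp add: algebra_simps)

lemma concat_inf_block:
  assumes "0 < L" "fa 0 = fa (real L)" "fb 0 = fb (real L)" "fa 0 = fb 0"
    and "x \<in> {0..real L}"
  shows "concat_inf L fa fb w (real n * real L + x) = pick fa fb (w !! n) x"
proof (cases "x = real L")
  case True
  then show ?thesis
    unfolding concat_inf_def True Let_def block_index_end[OF assms(1)]
    using assms by (simp add: pick_def algebra_simps split: letter.split)
next
  case False
  then have "0 \<le> x" "x < real L" using assms(5) by auto
  from block_index[OF assms(1) this] show ?thesis
    by (simp add: concat_inf_def)
qed

lemma concat_fin_block:
  assumes "0 < L" "fa 0 = fa (real L)" "fb 0 = fb (real L)" "fa 0 = fb 0"
    and "x \<in> {0..real L}" "n < length u"
  shows "concat_fin L fa fb u (real n * real L + x) = pick fa fb (u ! n) x"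
proof (cases "x = real L")
  case True
  show ?thesis
  proof (cases "Suc n < length u")
    case less: True
    then have "min (Suc n) (length u - 1) = Suc n" by simp
    then show ?thesis
      unfolding concat_fin_def True Let_def block_index_end[OF assms(1)]
      using assms by (simp add: pick_def algebra_simps split: letter.split)
  next
    case False
    then have "min (Suc n) (length u - 1) = n" using assms(6) by simp
    then show ?thesis
      unfolding concat_fin_def True Let_def block_index_end[OF assms(1)] by simp
  qed
next
  case False
  then have "0 \<le> x" "x < real L" using assms(5) by auto
  from block_index[OF assms(1) this] show ?thesis
    using assms(6) by (simp add: concat_fin_def)
qed

definition solution :: "nat \<Rightarrow> real \<Rightarrow> (real \<Rightarrow> real) \<Rightarrow> bool" where
  "solution L \<delta> f \<longleftrightarrow>
     (\<forall>T\<ge>0. interval_lebesgue_integrable lebesgue (ereal 0) (ereal T) f) \<and>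
     (\<forall>x\<ge>0. (LINT t=ereal 0..ereal (real L * x)|lebesgue. f t) = \<delta> * (f x - f 0))"

text \<open>Preservation of the empty word follows by cancellation.\<close>

definition substitution :: "(letter list \<Rightarrow> letter list) \<Rightarrow> bool" where
  "substitution \<sigma> \<longleftrightarrow> (\<forall>u v. \<sigma> (u @ v) = \<sigma> u @ \<sigma> v)"

definition uniform :: "nat \<Rightarrow> (letter list \<Rightarrow> letter list) \<Rightarrow> bool" where
  "uniform L \<sigma> \<longleftrightarrow> length (\<sigma> [La]) = L \<and> length (\<sigma> [Lb]) = L"

text \<open>Intended for \<open>\<sigma>\<close> with nonempty images of letters: \<^const>\<open>flat\<close> is only
  meaningful on streams of nonempty lists.\<close>

definition subst_inf :: "(letter list \<Rightarrow> letter list) \<Rightarrow> letter stream \<Rightarrow> letter stream" where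
  "subst_inf \<sigma> w = flat (smap (\<lambda>c. \<sigma> [c]) w)"

end

theory Submission
  imports Defs
begin

text \<open>Differentiating the equation gives \<open>L f(L x) = \<delta> f'(x)\<close>: the shape of \<open>f\<close> on an interval,
  even up to an additive constant, determines \<open>f\<close> itself on the interval dilated by \<open>L\<close>. If
  \<open>w_m = w_n\<close>, then \<open>f\<close> has the same shape on the \<open>m\<close>-th and \<open>n\<close>-th block of length \<open>L\<close>, hence
  the same values on the blocks of length \<open>L^2\<close> starting at \<open>m L^2\<close> and \<open>n L^2\<close>
  (\<open>agree_on_dilated_block\<close>). As soon as \<open>f_a\<close> and \<open>f_b\<close> differ, the letters
  \<open>w_(m L + j)\<close> and \<open>w_(n L + j)\<close> with \<open>j < L\<close> can be read off from these values, so they agree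
  (\<open>children_determined\<close>). This defines \<open>\<sigma>\<close> on every letter that occurs in \<open>w\<close>, and the
  integral formulas are the original equation restricted to one block.

  Three degenerate situations remain: \<open>f_a = f_b\<close>, a letter missing from \<open>w\<close>, and letter counts
  that differ between \<open>\<sigma>(a)\<close> and \<open>\<sigma>(b)\<close>. In all of them \<open>f\<close> vanishes, by one and the same
  argument (\<open>rigidity\<close>). Suppose a sequence \<open>v\<close> determines \<open>f\<close> on each block of length \<open>r\<close>, and
  \<open>f\<close> takes the value \<open>f(0)\<close> at every multiple of \<open>r\<close>. Then, by the equation, the increment of \<open>f\<close>
  over the \<open>k\<close>-th block of length \<open>r/L\<close> is a function \<open>J\<close> of \<open>v_k\<close>. It sums to zero over each
  group of \<open>L\<close> consecutive blocks, since these fill a block of length \<open>r\<close>. If such a \<open>J\<close>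
  must be zero, then the same hypotheses hold with \<open>r/L\<close> in place of \<open>r\<close>
  (\<open>refine_blocks\<close>). So \<open>f = f(0)\<close> on a dense set, \<open>f\<close> is constant by continuity, and the equation
  forces the constant to be \<open>0\<close>.

  In the first two situations \<open>f\<close> is periodic, \<open>v\<close> can be taken constant, and \<open>J\<close> is zero because
  \<open>L J = 0\<close>. In the third, with \<open>v = w\<close>, the vanishing sums are two linear equations
  \<open>p J_a + (L - p) J_b = 0\<close> and \<open>q J_a + (L - q) J_b = 0\<close> with \<open>p \<noteq> q\<close>, whose only solution is zero.\<close>

section \<open>Solutions of the integrated dilation equation\<close>

text \<open>The equation in incremental form, with the Henstock--Kurzweil integral: it no longer singles
  out the origin, so that it can be applied to any block.\<close>

locale dilation_solution =
  fixes L :: nat and \<delta> :: real and f :: "real \<Rightarrow> real"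
  assumes L2: "L \<ge> 2" and \<delta>0: "\<delta> \<noteq> 0"
    and cont: "continuous_on {0..} f"
    and incr: "\<lbrakk>0 \<le> x; x \<le> y\<rbrakk> \<Longrightarrow> integral {real L * x..real L * y} f = \<delta> * (f y - f x)"

text \<open>Continuity comes from the equation, which writes \<open>f\<close> as an indefinite integral.\<close>

lemma solution_imp_dilation_solution:
  assumes L2: "L \<ge> 2" and \<delta>0: "\<delta> \<noteq> 0" and sol: "solution L \<delta> f"
  shows "dilation_solution L \<delta> f"
proof -
  have int: "f integrable_on {0..T}" if "0 \<le> T" for T
  proof -
    have "set_integrable lebesgue {0<..<T} f"
      using sol that by (auto simp: solution_def interval_lebesgue_integrable_def)
    then show ?thesis
      using set_lebesgue_integral_eq_integral(1) integrable_on_Icc_iff_Ioo by blast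
  qed
  have eq: "integral {0..real L * x} f = \<delta> * (f x - f 0)" if "0 \<le> x" for x
  proof -
    have le: "0 \<le> real L * x" using that by simp
    have "set_integrable lebesgue {0<..<real L * x} f"
      using sol le by (auto simp: solution_def interval_lebesgue_integrable_def)
    then have "(LINT t=ereal 0..ereal (real L * x)|lebesgue. f t) = integral {0<..<real L * x} f"
      using le set_lebesgue_integral_eq_integral(2)[of "{0<..<real L * x}" f]
      by (simp add: interval_lebesgue_integral_def)
    then show ?thesis
      using sol that by (auto simp: solution_def integral_open_interval_real)
  qed
  have "continuous_on {0..T} f" if "0 \<le> T" for T
  proof -
    have "continuous_on {0..real L * T} (\<lambda>u. integral {0..u} f)"
      using that by (intro indefinite_integral_continuous_1 int) simp
    then have "continuous_on {0..T} (\<lambda>x. integral {0..real L * x} f)"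
      by (rule continuous_on_compose2) (auto intro!: continuous_intros mult_left_mono)
    then have "continuous_on {0..T} (\<lambda>x. f 0 + integral {0..real L * x} f / \<delta>)"
      using \<delta>0 by (auto intro!: continuous_intros)
    then show ?thesis
      by (rule continuous_on_eq) (use eq \<delta>0 in auto)
  qed
  then have cont: "continuous_on {0..} f"
    unfolding continuous_on_eq_continuous_within
  proof (intro ballI)
    fix x :: real assume *: "\<And>T. 0 \<le> T \<Longrightarrow> \<forall>x\<in>{0..T}. continuous (at x within {0..T}) f" "x \<in> {0..}"
    then have "continuous (at x within {0..x+1}) f" by auto
    moreover have "at x within {0..x+1} = at x within {0..}"
      by (rule at_within_nhd[of _ "{..<x+1}"]) auto
    ultimately show "continuous (at x within {0..}) f" by simp
  qed
  have "integral {real L * x..real L * y} f = \<delta> * (f y - f x)" if "0 \<le> x" "x \<le> y" for x y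
  proof -
    have "integral {0..real L * x} f + integral {real L * x..real L * y} f = integral {0..real L * y} f"
      using that by (intro Henstock_Kurzweil_Integration.integral_combine int) (auto intro: mult_left_mono)
    then show ?thesis using that eq[of x] eq[of y] by (simp add: algebra_simps)
  qed
  with L2 \<delta>0 cont show ?thesis by unfold_locales auto
qed

lemma continuous_eq_if_integrals_eq:
  fixes g h :: "real \<Rightarrow> real"
  assumes "0 < b" and g: "continuous_on {0..b} g" and h: "continuous_on {0..b} h"
    and eq: "\<And>s. s \<in> {0..b} \<Longrightarrow> integral {0..s} g = integral {0..s} h"
    and s: "s \<in> {0..b}"
  shows "g s = h s"
proof -
  have "((\<lambda>x. integral {0..x} g) has_vector_derivative g s) (at s within cbox 0 b)"
    using integral_has_vector_derivative[OF g s] by simp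
  moreover have "((\<lambda>x. integral {0..x} g) has_vector_derivative h s) (at s within cbox 0 b)"
    using has_vector_derivative_transform[of s "{0..b}" "\<lambda>x. integral {0..x} g" "\<lambda>x. integral {0..x} h" "h s"]
      integral_has_vector_derivative[OF h s] eq s
    by simp
  ultimately show ?thesis
    using vector_derivative_unique_within_closed_interval[of 0 b s] assms(1) s by auto
qed

context dilation_solution
begin

lemma L_pos: "0 < real L"
  using L2 by simp

lemma integral_shifted:
  assumes "0 \<le> x" "0 \<le> s"
  shows "integral {0..s} (\<lambda>t. f (real L * x + t)) = \<delta> * (f (x + s / real L) - f x)"
proof -
  have "integral {0..s} (\<lambda>t. f (real L * x + t)) = integral {real L * x..real L * (x + s / real L)} f"
    using integral_shift_Icc_real[of 0 s f "real L * x"] L_pos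
    by (simp add: o_def algebra_simps)
  also have "\<dots> = \<delta> * (f (x + s / real L) - f x)"
    using assms by (intro incr) auto
  finally show ?thesis .
qed

text \<open>Agreement of the increments of \<open>f\<close> is agreement of its integrals over the dilated intervals;
  for a continuous function the integrals recover the integrand.\<close>

lemma agree_on_dilated_block:
  assumes "0 \<le> x" "0 \<le> y" "0 < l" and agree: "\<And>s. s \<in> {0..l} \<Longrightarrow> f (x + s) = f (y + s)"
    and t: "t \<in> {0..real L * l}"
  shows "f (real L * x + t) = f (real L * y + t)"
proof (rule continuous_eq_if_integrals_eq[OF _ _ _ _ t])
  show "0 < real L * l" using assms L_pos by simp
  have "continuous_on {0..real L * l} (\<lambda>t. f (real L * z + t))" if "0 \<le> z" for z
    by (rule continuous_on_compose2[OF cont]) (use that in \<open>auto intro!: continuous_intros\<close>)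
  from this[OF assms(1)] this[OF assms(2)]
  show "continuous_on {0..real L * l} (\<lambda>t. f (real L * x + t))"
    "continuous_on {0..real L * l} (\<lambda>t. f (real L * y + t))" .
  fix s assume s: "s \<in> {0..real L * l}"
  then have "s / real L \<in> {0..l}" using L_pos by (auto simp: field_simps)
  then have "f (x + s / real L) = f (y + s / real L)" "f x = f y"
    using agree[of "s / real L"] agree[of 0] assms(3) by auto
  then show "integral {0..s} (\<lambda>t. f (real L * x + t)) = integral {0..s} (\<lambda>t. f (real L * y + t))"
    using s assms by (simp add: integral_shifted)
qed

text \<open>The property of the scale \<open>r\<close> that descends to \<open>r / L\<close>.\<close>

definition blocks_coded_by :: "(nat \<Rightarrow> 'a) \<Rightarrow> real \<Rightarrow> bool" where
  "blocks_coded_by v r \<longleftrightarrow>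
     (\<forall>k k'. \<forall>s\<in>{0..r}. v k = v k' \<longrightarrow> f (real k * r + s) = f (real k' * r + s)) \<and>
     (\<forall>k. f (real k * r) = f 0)"

text \<open>The hypothesis on \<open>J\<close> says that a weight on the symbols of \<open>v\<close> which sums to zero over each
  group of \<open>L\<close> consecutive positions is zero. It is applied to the increments of \<open>f\<close> over the blocks
  of length \<open>r / L\<close>, whose sum over a group telescopes to an increment of \<open>f\<close> between
  multiples of \<open>r\<close>.\<close>

lemma refine_blocks:
  fixes v :: "nat \<Rightarrow> 'a" and r :: real
  assumes r: "0 < r"
    and self_similar: "\<forall>J :: 'a \<Rightarrow> real.
      (\<forall>k. (\<Sum>j<L. J (v (k * L + j))) = 0) \<longrightarrow> (\<forall>k. J (v k) = 0)"
    and coded: "blocks_coded_by v r"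
  shows "blocks_coded_by v (r / real L)"
proof -
  define r' where "r' = r / real L"
  have blocks: "f (real k * r + s) = f (real k' * r + s)" if "v k = v k'" "s \<in> {0..r}" for k k' s
    using coded that unfolding blocks_coded_by_def by blast
  have nodes: "f (real k * r) = f 0" for k
    using coded unfolding blocks_coded_by_def by blast
  have Lr': "real L * (real k * r') = real k * r" for k
    using L_pos by (simp add: r'_def)
  have rise: "f (real k * r' + s) - f (real k * r') = f (real k' * r' + s) - f (real k' * r')"
    if v: "v k = v k'" and s: "s \<in> {0..r'}" for k k' s
  proof -
    have Ls: "real L * s \<in> {0..r}"
      using s L_pos by (auto simp: r'_def field_simps)
    have "\<delta> * (f (real k * r' + s) - f (real k * r'))
        = integral {0..real L * s} (\<lambda>t. f (real k * r + t))" for k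
      using integral_shifted[of "real k * r'" "real L * s"] s r L_pos
      by (simp add: Lr')
    moreover have "integral {0..real L * s} (\<lambda>t. f (real k * r + t))
        = integral {0..real L * s} (\<lambda>t. f (real k' * r + t))"
      by (rule integral_cong) (use blocks[OF v] Ls in auto)
    ultimately show ?thesis using \<delta>0 by (metis mult_left_cancel)
  qed
  have r': "0 < r'" using r L_pos by (simp add: r'_def)
  \<comment> \<open>\<open>E\<close> is the increment over the \<open>k\<close>-th block of length \<open>r'\<close>, \<open>J\<close> the same increment as a
    function of the symbol; any position carrying that symbol may represent it, by \<open>rise\<close>.\<close>
  define E where "E k = f (real (Suc k) * r') - f (real k * r')" for k
  define J where "J c = E (SOME k. v k = c)" for c
  have E: "E k = J (v k)" for k
  proof -
    have "v (SOME k'. v k' = v k) = v k" by (rule someI) simp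
    from rise[OF this, of r'] r' show ?thesis
      by (simp add: J_def E_def algebra_simps)
  qed
  have "(\<Sum>j<L. J (v (k * L + j))) = 0" for k
  proof -
    have "(\<Sum>j<L. J (v (k * L + j)))
        = (\<Sum>j<L. f (real (k * L + Suc j) * r') - f (real (k * L + j) * r'))"
      by (simp add: E[symmetric] E_def)
    also have "\<dots> = f (real (k * L + L) * r') - f (real (k * L) * r')"
      using sum_lessThan_telescope[of "\<lambda>j. f (real (k * L + j) * r')" L] by simp
    also have "\<dots> = f (real (Suc k) * r) - f (real k * r)"
      using L_pos by (simp add: r'_def algebra_simps add_divide_distrib)
    finally show ?thesis using nodes[of "Suc k"] nodes[of k] by simp
  qed
  then have E0: "E k = 0" for k unfolding E using self_similar by blast
  have nodes': "f (real k * r') = f 0" for k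
  proof (induction k)
    case (Suc k)
    then show ?case using E0[of k] unfolding E_def by simp
  qed simp
  have "f (real k * r' + s) = f (real k' * r' + s)" if "s \<in> {0..r'}" "v k = v k'" for k k' s
    using rise[OF that(2,1)] by (simp add: nodes')
  with nodes' show ?thesis unfolding blocks_coded_by_def r'_def by blast
qed

lemma dense_grid_constant:
  assumes nodes: "\<And>m k. f (real k * (b / real L ^ m)) = f 0" and b: "0 < b" and x: "0 \<le> x"
  shows "f x = f 0"
proof -
  define r where "r m = b / real L ^ m" for m
  have r: "0 < r m" for m using b L_pos by (simp add: r_def)
  define y where "y m = real (nat \<lfloor>x / r m\<rfloor>) * r m" for m
  have y: "y m \<le> x" "x - r m \<le> y m" "0 \<le> y m" for m
  proof -
    have *: "real (nat \<lfloor>x / r m\<rfloor>) = of_int \<lfloor>x / r m\<rfloor>"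
      using x r[of m] by simp
    have "real (nat \<lfloor>x / r m\<rfloor>) \<le> x / r m" "x / r m \<le> real (nat \<lfloor>x / r m\<rfloor>) + 1"
      unfolding * by linarith+
    then show "y m \<le> x" "x - r m \<le> y m" "0 \<le> y m"
      using r[of m] by (auto simp: y_def field_simps)
  qed
  have "r \<longlonglongrightarrow> 0"
  proof -
    have "(\<lambda>m. b * (1 / real L) ^ m) \<longlonglongrightarrow> b * 0"
      using L2 by (intro tendsto_intros LIMSEQ_power_zero) auto
    then show ?thesis by (simp add: r_def[abs_def] power_one_over divide_simps)
  qed
  then have "(\<lambda>m. x - r m) \<longlonglongrightarrow> x - 0" by (intro tendsto_intros)
  then have "y \<longlonglongrightarrow> x"
    by (intro tendsto_sandwich[of "\<lambda>m. x - r m" y _ "\<lambda>_. x"]) (use y in auto)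
  then have "(\<lambda>m. f (y m)) \<longlonglongrightarrow> f x"
    using x y by (intro continuous_on_tendsto_compose[OF cont]) auto
  moreover have "f (y m) = f 0" for m
    using nodes[of "nat \<lfloor>x / r m\<rfloor>" m] by (simp add: y_def r_def)
  ultimately show ?thesis by (simp add: LIMSEQ_const_iff)
qed

text \<open>Refinement puts the value \<open>f 0\<close> on all points \<open>k b / L^m\<close>, a dense set. The only constant
  solution is zero, as the integral of \<open>f\<close> over \<open>[0, L]\<close> is a multiple of \<open>f 1 - f 0\<close>.\<close>

lemma rigidity:
  fixes v :: "nat \<Rightarrow> 'a"
  assumes b: "0 < b"
    and self_similar: "\<forall>J :: 'a \<Rightarrow> real.
      (\<forall>k. (\<Sum>j<L. J (v (k * L + j))) = 0) \<longrightarrow> (\<forall>k. J (v k) = 0)"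
    and coded: "blocks_coded_by v b"
    and x: "0 \<le> x"
  shows "f x = 0"
proof -
  have "blocks_coded_by v (b / real L ^ m)" for m
  proof (induction m)
    case (Suc m)
    have "0 < b / real L ^ m" using b L_pos by simp
    from refine_blocks[OF this self_similar Suc] show ?case
      by (simp add: divide_divide_eq_left mult.commute)
  qed (simp add: coded)
  then have const: "f y = f 0" if "0 \<le> y" for y
    using dense_grid_constant[OF _ b that] unfolding blocks_coded_by_def by simp
  have "integral {0..real L} f = 0"
    using incr[of 0 1] const[of 1] by simp
  moreover have "integral {0..real L} f = integral {0..real L} (\<lambda>_. f 0)"
    by (rule integral_cong, rule const) simp
  ultimately have "f 0 = 0" using L_pos by simp
  with const x show ?thesis by simp
qed

end

section \<open>Uniform substitutions\<close>

lemma snth_flat_uniform: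
  assumes len: "\<And>c. length (\<tau> c) = L" and j: "j < L"
  shows "flat (smap \<tau> w) !! (n * L + j) = \<tau> (w !! n) ! j"
proof (induction n arbitrary: w)
  have unfold: "flat (smap \<tau> w) = \<tau> (shd w) @- flat (smap \<tau> (stl w))" for w
    using flat_unfold[of "smap \<tau> w"] len[of "shd w"] j by fastforce
  {
    case 0
    show ?case using unfold[of w] j len by (simp add: shift_snth_less)
  next
    case (Suc n)
    show ?case using unfold[of w] Suc[of "stl w"] len[of "shd w"] by (simp add: shift_snth_ge)
  }
qed

text \<open>For images of equal length the fixed point equation is a condition on digits: position
  \<open>n L + j\<close> of the image lies in the \<open>n\<close>-th word.\<close>

lemma flat_uniform_fixpoint_iff:
  assumes len: "\<And>c. length (\<tau> c) = L" and L: "0 < L"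
  shows "flat (smap \<tau> w) = w \<longleftrightarrow> (\<forall>n. \<forall>j<L. \<tau> (w !! n) ! j = w !! (n * L + j))"
proof
  assume fixed: "flat (smap \<tau> w) = w"
  show "\<forall>n. \<forall>j<L. \<tau> (w !! n) ! j = w !! (n * L + j)"
  proof (intro allI impI)
    fix n j assume "j < L"
    from snth_flat_uniform[of \<tau>, OF len this, where w = w and n = n]
    show "\<tau> (w !! n) ! j = w !! (n * L + j)" unfolding fixed by (rule sym)
  qed
next
  assume R: "\<forall>n. \<forall>j<L. \<tau> (w !! n) ! j = w !! (n * L + j)"
  have "flat (smap \<tau> w) !! i = w !! i" for i
    using snth_flat_uniform[of \<tau>, OF len, where j = "i mod L" and w = w and n = "i div L"] R L by simp
  then have "snth (flat (smap \<tau> w)) = snth w" by (rule ext)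
  then have "smap (snth (flat (smap \<tau> w))) nats = smap (snth w) nats" by (rule arg_cong)
  then show "flat (smap \<tau> w) = w" by (simp only: stream_smap_nats[symmetric])
qed

lemma substitution_eq_concat_map:
  assumes "substitution \<sigma>"
  shows "\<sigma> u = concat (map (\<lambda>c. \<sigma> [c]) u)"
proof (induction u)
  case Nil
  have "\<sigma> ([] @ []) = \<sigma> [] @ \<sigma> []" using assms unfolding substitution_def by blast
  then show ?case by simp
next
  case (Cons c u)
  have "\<sigma> ([c] @ u) = \<sigma> [c] @ \<sigma> u" using assms unfolding substitution_def by blast
  with Cons show ?case by simp
qed

text \<open>Turns a vanishing weight sum over a word into a linear equation for the two letter weights.\<close>

lemma sum_over_letters:
  fixes J :: "letter \<Rightarrow> real"
  shows "(\<Sum>j<length u. J (u ! j))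
    = real (count_list u La) * J La + (real (length u) - real (count_list u La)) * J Lb"
proof -
  have "sum_list (map J u)
    = real (count_list u La) * J La + (real (length u) - real (count_list u La)) * J Lb"
  proof (induction u)
    case (Cons c u)
    then show ?case by (cases c) (simp_all add: algebra_simps)
  qed simp
  then show ?thesis by (simp add: sum_list_sum_nth atLeast0LessThan)
qed

section \<open>Solutions concatenated from two functions\<close>

locale two_block_solution =
  fixes L :: nat and \<delta> :: real and fa fb :: "real \<Rightarrow> real" and w :: "letter stream"
  assumes L_ge_2: "L \<ge> 2" and \<delta>_nonzero: "\<delta> \<noteq> 0"
    and ends: "fa 0 = fa (real L)" "fa (real L) = fb 0" "fb 0 = fb (real L)"
    and sol: "solution L \<delta> (concat_inf L fa fb w)"
    and nonzero: "\<exists>t\<ge>0. concat_inf L fa fb w t \<noteq> 0"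
begin

abbreviation F :: "real \<Rightarrow> real" where "F \<equiv> concat_inf L fa fb w"

sublocale dilation_solution L \<delta> F
  using solution_imp_dilation_solution[OF L_ge_2 \<delta>_nonzero sol] .

lemma F_block: "s \<in> {0..real L} \<Longrightarrow> F (real n * real L + s) = pick fa fb (w !! n) s"
  using concat_inf_block[of L fa fb s w n] ends L2 by simp

lemma F_node: "F (real n * real L) = fa 0"
  using F_block[of 0 n] ends by (cases "w !! n") (auto simp: pick_def)

text \<open>The common source of both nondegeneracy facts that follow: a solution of period \<open>L\<close> is coded by
  a constant sequence, and rigidity makes it vanish.\<close>

lemma not_periodic: "\<exists>k. \<exists>s\<in>{0..real L}. F (real k * real L + s) \<noteq> F s"
proof (rule ccontr)
  assume "\<not> ?thesis"
  then have per: "F (real k * real L + s) = F s" if "s \<in> {0..real L}" for k s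
    using that by blast
  have "blocks_coded_by (\<lambda>_. ()) (real L)"
    unfolding blocks_coded_by_def using per F_node F_node[of 0] by simp
  moreover have "\<forall>J :: unit \<Rightarrow> real. (\<forall>k :: nat. (\<Sum>j<L. J ()) = 0) \<longrightarrow> (\<forall>k :: nat. J () = 0)"
    using L2 by simp
  ultimately show False
    using rigidity[of "real L" "\<lambda>_. ()"] L_pos nonzero by blast
qed

lemma blocks_differ: "\<exists>s\<in>{0..real L}. fa s \<noteq> fb s"
proof (rule ccontr)
  assume "\<not> ?thesis"
  then have "pick fa fb c s = fa s" if "s \<in> {0..real L}" for c s
    using that by (cases c) (auto simp: pick_def)
  then have "F (real k * real L + s) = fa s" if "s \<in> {0..real L}" for k s
    using that F_block by simp
  from this this[of _ 0] show False using not_periodic by fastforce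
qed

lemma letter_occurs: "\<exists>n. w !! n = c"
proof (rule ccontr)
  assume "\<not> ?thesis"
  then have "w !! n = w !! 0" for n
    by (metis letter.exhaust)
  then have "F (real k * real L + s) = F (real 0 * real L + s)" if "s \<in> {0..real L}" for k s
    using that F_block by metis
  then show False using not_periodic by fastforce
qed

text \<open>A point where \<open>fa\<close> and \<open>fb\<close> differ reveals the letter of any block from the value of \<open>F\<close> at the
  corresponding point of that block.\<close>

lemma children_determined:
  assumes "w !! m = w !! n" "j < L"
  shows "w !! (m * L + j) = w !! (n * L + j)"
proof -
  obtain s where s: "s \<in> {0..real L}" "fa s \<noteq> fb s"
    using blocks_differ by blast
  have "real j * real L + s \<le> real j * real L + real L" using s by simp
  also have "\<dots> = real (Suc j) * real L" by (simp add: algebra_simps)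
  also have "\<dots> \<le> real L * real L" using assms(2) by (intro mult_right_mono) auto
  finally have t: "real j * real L + s \<in> {0..real L * real L}"
    using s by simp
  have "F (real L * (real m * real L) + (real j * real L + s))
      = F (real L * (real n * real L) + (real j * real L + s))"
    by (rule agree_on_dilated_block[OF _ _ L_pos _ t]) (use F_block assms(1) in auto)
  moreover have "F (real L * (real i * real L) + (real j * real L + s))
      = pick fa fb (w !! (i * L + j)) s" for i
    using F_block[OF s(1), of "i * L + j"] by (simp add: algebra_simps)
  ultimately have "pick fa fb (w !! (m * L + j)) s = pick fa fb (w !! (n * L + j)) s"
    by simp
  with s(2) show ?thesis
    by (cases "w !! (m * L + j)"; cases "w !! (n * L + j)") (auto simp: pick_def)
qed

text \<open>The integrals of \<open>fa\<close> and \<open>fb\<close> give equality of the counts only if these integrals are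
  different. Rigidity covers the remaining case as well: different counts leave no nonzero letter
  weight with vanishing sums over the words \<open>\<tau> c\<close>.\<close>

lemma counts_equal:
  assumes len: "\<And>c. length (\<tau> c) = L"
    and \<tau>: "\<And>n j. j < L \<Longrightarrow> \<tau> (w !! n) ! j = w !! (n * L + j)"
  shows "count_list (\<tau> La) La = count_list (\<tau> Lb) La"
proof (rule ccontr)
  assume ne: "count_list (\<tau> La) La \<noteq> count_list (\<tau> Lb) La"
  have "J (w !! k) = 0" if J: "\<forall>k. (\<Sum>j<L. J (w !! (k * L + j))) = 0" for J :: "letter \<Rightarrow> real" and k
  proof -
    have sum0: "real (count_list (\<tau> c) La) * (J La - J Lb) + real L * J Lb = 0" for c
    proof -
      obtain n where n: "w !! n = c" using letter_occurs by blast
      have "(\<Sum>j<length (\<tau> c). J (\<tau> c ! j)) = (\<Sum>j<L. J (w !! (n * L + j)))"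
        using \<tau>[of _ n] n len by simp
      also have "\<dots> = 0" using J by blast
      finally show ?thesis
        using sum_over_letters[of J "\<tau> c"] len[of c] by (simp add: algebra_simps)
    qed
    from sum0[of La] sum0[of Lb]
    have "(real (count_list (\<tau> La) La) - real (count_list (\<tau> Lb) La)) * (J La - J Lb) = 0"
      by (simp add: algebra_simps)
    with ne have "J La = J Lb" by simp
    with sum0[of La] L2 show ?thesis by (cases "w !! k") auto
  qed
  then have "\<forall>J :: letter \<Rightarrow> real.
      (\<forall>k. (\<Sum>j<L. J (w !! (k * L + j))) = 0) \<longrightarrow> (\<forall>k. J (w !! k) = 0)"
    by blast
  moreover have "blocks_coded_by (\<lambda>k. w !! k) (real L)"
    unfolding blocks_coded_by_def using F_block F_node F_node[of 0] by simp
  ultimately show False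
    using rigidity[of "real L" "\<lambda>k. w !! k"] L_pos nonzero by blast
qed

lemma concat_fin_eq_F:
  assumes len: "length u = L" and u: "\<And>j. j < L \<Longrightarrow> u ! j = w !! (n * L + j)"
    and t: "t \<in> {0..real L * real L}"
  shows "concat_fin L fa fb u t = F (real L * (real n * real L) + t)"
proof -
  have "\<exists>j<L. \<exists>s\<in>{0..real L}. t = real j * real L + s"
  \<comment> \<open>The right end point belongs to block \<open>L - 1\<close> at offset \<open>L\<close>; rounding would place it in
    block \<open>L\<close>, past the end of \<open>u\<close>.\<close>
  proof (cases "t = real L * real L")
    case True
    then have "t = real (L - 1) * real L + real L"
      using L2 by (simp add: of_nat_diff algebra_simps)
    then show ?thesis using L2 by (intro exI[of _ "L - 1"]) auto
  next
    case False
    define j where "j = nat \<lfloor>t / real L\<rfloor>"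
    have j: "real j = of_int \<lfloor>t / real L\<rfloor>" using t L_pos by (simp add: j_def)
    have "real j \<le> t / real L" "t / real L < real j + 1" unfolding j by linarith+
    then have bounds: "real j * real L \<le> t" "t < real j * real L + real L"
      using L_pos by (auto simp: field_simps)
    have "t < real L * real L" using t False by simp
    with bounds have "real j * real L < real L * real L" by linarith
    then have "real j < real L" using L_pos mult_less_cancel_right_pos by blast
    then have "j < L" by simp
    with bounds show ?thesis
      by (intro exI[of _ j] conjI bexI[of _ "t - real j * real L"]) auto
  qed
  then obtain j s where js: "j < L" "s \<in> {0..real L}" "t = real j * real L + s" by blast
  then have "concat_fin L fa fb u t = pick fa fb (u ! j) s"
    using concat_fin_block[of L fa fb s j u] ends L2 len by simp
  also have "\<dots> = F (real (n * L + j) * real L + s)"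
    by (simp only: F_block[OF js(2)] u[OF js(1)])
  finally show ?thesis by (simp add: js(3) algebra_simps)
qed

lemma concat_fin_integral_le:
  assumes len: "length u = L" and u: "\<And>j. j < L \<Longrightarrow> u ! j = w !! (n * L + j)"
    and xy: "0 \<le> x" "x \<le> y" "y \<le> real L"
  shows "interval_lebesgue_integrable lebesgue (ereal (real L * x)) (ereal (real L * y))
           (concat_fin L fa fb u)"
    and "(LINT t=ereal (real L * x)..ereal (real L * y)|lebesgue. concat_fin L fa fb u t)
           = \<delta> * (pick fa fb (w !! n) y - pick fa fb (w !! n) x)"
proof -
  let ?I = "{real L * x..real L * y}" and ?c = "real L * (real n * real L)"
  have le: "real L * x \<le> real L * y" using xy by (intro mult_left_mono) auto
  have sub: "?I \<subseteq> {0..real L * real L}"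
  proof
    fix t assume "t \<in> ?I"
    moreover have "real L * y \<le> real L * real L" "0 \<le> real L * x"
      using xy by (auto intro: mult_left_mono)
    ultimately show "t \<in> {0..real L * real L}" by auto
  qed
  have eq: "concat_fin L fa fb u t = F (?c + t)" if "t \<in> ?I" for t
    using concat_fin_eq_F[OF len u] sub that by blast
  have "continuous_on ?I (\<lambda>t. F (?c + t))"
  proof (rule continuous_on_compose2[OF cont])
    show "(\<lambda>t. ?c + t) ` ?I \<subseteq> {0..}" using sub by (auto intro!: add_nonneg_nonneg)
  qed (intro continuous_intros)
  then have "continuous_on ?I (concat_fin L fa fb u)"
    by (rule continuous_on_eq) (simp add: eq)
  then have "set_integrable lebesgue ?I (concat_fin L fa fb u)"
    by (rule absolutely_integrable_continuous_real)
  then have int: "set_integrable lebesgue {real L * x<..<real L * y} (concat_fin L fa fb u)"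
    using absolutely_integrable_on_Icc_iff_Ioo by blast
  then show "interval_lebesgue_integrable lebesgue (ereal (real L * x)) (ereal (real L * y))
      (concat_fin L fa fb u)"
    using le by (simp add: interval_lebesgue_integrable_def)
  have "(LINT t=ereal (real L * x)..ereal (real L * y)|lebesgue. concat_fin L fa fb u t)
      = integral ?I (concat_fin L fa fb u)"
    using le set_lebesgue_integral_eq_integral(2)[OF int]
    by (simp add: interval_lebesgue_integral_def integral_open_interval_real)
  also have "\<dots> = integral ?I (F \<circ> ((+) ?c))"
    by (rule integral_cong) (simp add: eq)
  also have "\<dots> = integral {real L * (real n * real L + x)..real L * (real n * real L + y)} F"
    by (simp add: integral_shift_Icc_real algebra_simps)
  also have "\<dots> = \<delta> * (F (real n * real L + y) - F (real n * real L + x))"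
    using xy by (intro incr) auto
  also have "\<dots> = \<delta> * (pick fa fb (w !! n) y - pick fa fb (w !! n) x)"
    using xy F_block by simp
  finally show "(LINT t=ereal (real L * x)..ereal (real L * y)|lebesgue. concat_fin L fa fb u t)
      = \<delta> * (pick fa fb (w !! n) y - pick fa fb (w !! n) x)" .
qed

lemma concat_fin_integral:
  assumes len: "length u = L" and u: "\<And>j. j < L \<Longrightarrow> u ! j = w !! (n * L + j)"
    and x: "x \<in> {0..real L}" and y: "y \<in> {0..real L}"
  shows "interval_lebesgue_integrable lebesgue (ereal (real L * x)) (ereal (real L * y))
           (concat_fin L fa fb u) \<and>
         (LINT t=ereal (real L * x)..ereal (real L * y)|lebesgue. concat_fin L fa fb u t)
           = \<delta> * (pick fa fb (w !! n) y - pick fa fb (w !! n) x)"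
proof (cases "x \<le> y")
  case True
  then show ?thesis using concat_fin_integral_le[OF len u] x y by auto
next
  case False
  then have yx: "0 \<le> y" "y \<le> x" "x \<le> real L" using x y by auto
  note rev = concat_fin_integral_le[OF len u this]
  have lt: "real L * y < real L * x" using False L_pos by simp
  show ?thesis
    using rev lt
    by (auto simp: interval_lebesgue_integrable_def interval_lebesgue_integral_def algebra_simps)
qed

lemma fixing_substitution_iff:
  assumes "uniform L \<sigma>"
  shows "subst_inf \<sigma> w = w \<longleftrightarrow> (\<forall>n. \<forall>j<L. \<sigma> [w !! n] ! j = w !! (n * L + j))"
proof -
  have "length (\<sigma> [c]) = L" for c
    using assms by (cases c) (auto simp: uniform_def)
  then show ?thesis
    unfolding subst_inf_def using flat_uniform_fixpoint_iff[of "\<lambda>c. \<sigma> [c]" L w] L2 by simp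
qed

lemma ex1_fixing_substitution: "\<exists>!\<sigma>. substitution \<sigma> \<and> uniform L \<sigma> \<and> subst_inf \<sigma> w = w"
proof (rule ex_ex1I)
  \<comment> \<open>The image of \<open>c\<close> is read off below an arbitrary occurrence of \<open>c\<close>.\<close>
  define pos where "pos c = (SOME n. w !! n = c)" for c
  have pos: "w !! pos c = c" for c
    unfolding pos_def by (rule someI_ex[OF letter_occurs])
  define \<tau> where "\<tau> c = map (\<lambda>j. w !! (pos c * L + j)) [0..<L]" for c
  define \<sigma> where "\<sigma> u = concat (map \<tau> u)" for u
  have uni: "uniform L \<sigma>" by (simp add: uniform_def \<sigma>_def \<tau>_def)
  have "\<sigma> [w !! n] ! j = w !! (n * L + j)" if "j < L" for n j
    using children_determined[of "pos (w !! n)" n j] that pos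
    by (simp add: \<sigma>_def \<tau>_def)
  with uni have "subst_inf \<sigma> w = w" by (simp add: fixing_substitution_iff)
  moreover have "substitution \<sigma>" by (simp add: substitution_def \<sigma>_def)
  ultimately show "\<exists>\<sigma>. substitution \<sigma> \<and> uniform L \<sigma> \<and> subst_inf \<sigma> w = w" using uni by blast
next
  fix \<sigma> \<rho>
  assume \<sigma>: "substitution \<sigma> \<and> uniform L \<sigma> \<and> subst_inf \<sigma> w = w"
    and \<rho>: "substitution \<rho> \<and> uniform L \<rho> \<and> subst_inf \<rho> w = w"
  have letters: "\<sigma> [c] = \<rho> [c]" for c
  proof (rule nth_equalityI)
    have len: "length (\<sigma> [c]) = L" "length (\<rho> [c]) = L"
      using \<sigma> \<rho> by (cases c; auto simp: uniform_def)+
    then show "length (\<sigma> [c]) = length (\<rho> [c])" by simp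
    obtain n where "w !! n = c" using letter_occurs by blast
    then show "\<sigma> [c] ! j = \<rho> [c] ! j" if "j < length (\<sigma> [c])" for j
      using \<sigma> \<rho> that len fixing_substitution_iff by metis
  qed
  show "\<sigma> = \<rho>"
  proof
    fix u
    have "\<sigma> u = concat (map (\<lambda>c. \<sigma> [c]) u)"
      using \<sigma> by (intro substitution_eq_concat_map) simp
    also have "\<dots> = concat (map (\<lambda>c. \<rho> [c]) u)" by (simp only: letters)
    also have "\<dots> = \<rho> u"
      using \<rho> by (intro substitution_eq_concat_map[symmetric]) simp
    finally show "\<sigma> u = \<rho> u" .
  qed
qed

end

theorem mainTheorem3:
  fixes L :: nat and \<delta> :: real and fa fb :: "real \<Rightarrow> real" and w :: "letter stream"
  assumes "L \<ge> 2" and "\<delta> \<noteq> 0"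
    and "fa 0 = fa (real L)" and "fa (real L) = fb 0" and "fb 0 = fb (real L)"
    and "solution L \<delta> (concat_inf L fa fb w)"
    and "\<exists>t\<ge>0. concat_inf L fa fb w t \<noteq> 0"
  shows "(\<exists>!\<sigma>. substitution \<sigma> \<and> uniform L \<sigma> \<and> subst_inf \<sigma> w = w) \<and>
    (\<forall>\<sigma>. substitution \<sigma> \<and> uniform L \<sigma> \<and> subst_inf \<sigma> w = w \<longrightarrow>
      count_list (\<sigma> [La]) La = count_list (\<sigma> [Lb]) La \<and>
      (\<forall>x\<in>{0..real L}. \<forall>y\<in>{0..real L}.
        (interval_lebesgue_integrable lebesgue (ereal (real L * x)) (ereal (real L * y))
           (concat_fin L fa fb (\<sigma> [La])) \<and>
         (LINT t=ereal (real L * x)..ereal (real L * y)|lebesgue. concat_fin L fa fb (\<sigma> [La]) t)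
           = \<delta> * (fa y - fa x)) \<and>
        (interval_lebesgue_integrable lebesgue (ereal (real L * x)) (ereal (real L * y))
           (concat_fin L fa fb (\<sigma> [Lb])) \<and>
         (LINT t=ereal (real L * x)..ereal (real L * y)|lebesgue. concat_fin L fa fb (\<sigma> [Lb]) t)
           = \<delta> * (fb y - fb x))))"
proof -
  interpret two_block_solution L \<delta> fa fb w
    by (rule two_block_solution.intro) (fact assms)+
  show ?thesis
  proof (intro conjI[OF ex1_fixing_substitution] allI impI)
    fix \<sigma> assume \<sigma>: "substitution \<sigma> \<and> uniform L \<sigma> \<and> subst_inf \<sigma> w = w"
    then have len: "length (\<sigma> [c]) = L" for c
      by (cases c) (auto simp: uniform_def)
    have nth: "\<sigma> [w !! n] ! j = w !! (n * L + j)" if "j < L" for n j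
      using \<sigma> that fixing_substitution_iff by blast
    have counts: "count_list (\<sigma> [La]) La = count_list (\<sigma> [Lb]) La"
      using counts_equal[of "\<lambda>c. \<sigma> [c]"] len nth by blast
    have ints: "interval_lebesgue_integrable lebesgue (ereal (real L * x)) (ereal (real L * y))
          (concat_fin L fa fb (\<sigma> [c])) \<and>
        (LINT t=ereal (real L * x)..ereal (real L * y)|lebesgue. concat_fin L fa fb (\<sigma> [c]) t)
          = \<delta> * (pick fa fb c y - pick fa fb c x)"
      if "x \<in> {0..real L}" "y \<in> {0..real L}" for x y c
    proof -
      obtain n where n: "w !! n = c" using letter_occurs by blast
      show ?thesis
        using concat_fin_integral[OF len _ that, of c n] nth[of _ n] unfolding n by blast
    qed
    from counts ints[of _ _ La] ints[of _ _ Lb]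
    show "count_list (\<sigma> [La]) La = count_list (\<sigma> [Lb]) La \<and>
      (\<forall>x\<in>{0..real L}. \<forall>y\<in>{0..real L}.
        (interval_lebesgue_integrable lebesgue (ereal (real L * x)) (ereal (real L * y))
           (concat_fin L fa fb (\<sigma> [La])) \<and>
         (LINT t=ereal (real L * x)..ereal (real L * y)|lebesgue. concat_fin L fa fb (\<sigma> [La]) t)
           = \<delta> * (fa y - fa x)) \<and>
        (interval_lebesgue_integrable lebesgue (ereal (real L * x)) (ereal (real L * y))
           (concat_fin L fa fb (\<sigma> [Lb])) \<and>
         (LINT t=ereal (real L * x)..ereal (real L * y)|lebesgue. concat_fin L fa fb (\<sigma> [Lb]) t)
           = \<delta> * (fb y - fb x)))"
      by (simp add: pick_def)
  qed
qed

end
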